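(* Let $h(\mathbf{X},\{\boldsymbol{\Phi}_i\})=\sum_{k=1}^{K}q_k\bigl(2\mathrm{Re}(\sqrt{\mathbf{C}}_k^{\mathsf{H}}(\mathbf{X})\boldsymbol{\Phi}_k)-\boldsymbol{\Phi}_k^{\mathsf{H}}\mathbf{D}_k(\mathbf{X})\boldsymbol{\Phi}_k\bigr)$ be the objective of the quadratic-transformed problem, and let $F(\mathbf{X})=\sum_{k=1}^{K}q_k\bigl(\sqrt{\mathbf{C}}_k^{\mathsf{H}}(\mathbf{X})\mathbf{D}_k^{-1}(\mathbf{X})\sqrt{\mathbf{C}}_k(\mathbf{X})\bigr)$ be the original objective on $\mathcal{X}$. Then updating $\{\boldsymbol{\Phi}_i\}$ in the transformed problem by block coordinate ascent amounts to constructing the quadratic surrogate of $F$. Precisely: for fixed $\underline{\mathbf{X}}\in\mathcal{X}$, the choice $\underline{\boldsymbol{\Phi}}_k=\mathbf{D}_k(\underline{\mathbf{X}})^{-1}\sqrt{\mathbf{C}}_k(\underline{\mathbf{X}})$, $k=1,\dots,K$, maximizes $h(\underline{\mathbf{X}},\{\boldsymbol{\Phi}_i\})$ over $\{\boldsymbol{\Phi}_i\}$, and with this choice, for every $\mathbf{X}\in\mathcal{X}$, $$h(\mathbf{X},\{\underline{\boldsymbol{\Phi}}_i\})=\sum_{k=1}^{K}q_k\Bigl(2\mathrm{Re}\bigl(\underline{\mathbf{Z}}_{1,k}^{\mathsf{H}}\underline{\mathbf{Z}}_{2,k}^{-1}\mathbf{Z}_{1,k}\bigr)-\underline{\mathbf{Z}}_{1,k}^{\mathsf{H}}\underline{\mathbf{Z}}_{2,k}^{-1}\mathbf{Z}_{2,k}\underline{\mathbf{Z}}_{2,k}^{-1}\underline{\mathbf{Z}}_{1,k}\Bigr),$$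 where $\mathbf{Z}_{1,k}=\sqrt{\mathbf{C}}_k(\mathbf{X})$, $\mathbf{Z}_{2,k}=\mathbf{D}_k(\mathbf{X})$, $\underline{\mathbf{Z}}_{1,k}=\sqrt{\mathbf{C}}_k(\underline{\mathbf{X}})$, $\underline{\mathbf{Z}}_{2,k}=\mathbf{D}_k(\underline{\mathbf{X}})$. The right-hand side is the surrogate function of $F$ at $\underline{\mathbf{X}}$ obtained by applying, to each summand of $F$, the lower bound $q(\mathbf{Z}_1^{\mathsf{H}}\mathbf{Z}_2^{-1}\mathbf{Z}_1)\ge q\bigl(2\mathrm{Re}(\underline{\mathbf{Z}}_1^{\mathsf{H}}\underline{\mathbf{Z}}_2^{-1}\mathbf{Z}_1)-\underline{\mathbf{Z}}_1^{\mathsf{H}}\underline{\mathbf{Z}}_2^{-1}\mathbf{Z}_2\underline{\mathbf{Z}}_2^{-1}\underline{\mathbf{Z}}_1\bigr)$ (valid for nondecreasing $q$ and $\mathbf{Z}_2,\underline{\mathbf{Z}}_2\succ\mathbf{0}$, with equality at $(\mathbf{Z}_1,\mathbf{Z}_2)=(\underline{\mathbf{Z}}_1,\underline{\mathbf{Z}}_2)$).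
   Context: $\mathcal{X}$ is a set (of matrices). For $k=1,\dots,K$ and $\mathbf{X}\in\mathcal{X}$, $\mathbf{C}_k(\mathbf{X})\succeq\mathbf{0}$ and $\mathbf{D}_k(\mathbf{X})\succ\mathbf{0}$ are Hermitian complex $n_k\times n_k$ matrices, and $\sqrt{\mathbf{C}}_k(\mathbf{X})\in\mathbb{C}^{n_k\times m_k}$ is a factor with $\sqrt{\mathbf{C}}_k(\mathbf{X})\sqrt{\mathbf{C}}_k^{\mathsf{H}}(\mathbf{X})=\mathbf{C}_k(\mathbf{X})$. Each $q_k$ is a real-valued nondecreasing function on Hermitian $m_k\times m_k$ matrices: $q_k(\mathbf{Z}_1)\ge q_k(\mathbf{Z}_2)$ whenever $\mathbf{Z}_1\succeq\mathbf{Z}_2$. The variables $\boldsymbol{\Phi}_k$ range over $\mathbb{C}^{n_k\times m_k}$. For a square matrix $\mathbf{A}$, $2\mathrm{Re}(\mathbf{A})=\mathbf{A}+\mathbf{A}^{\mathsf{H}}$. $\succeq$ ($\succ$) denotes positive semidefinite (definite) order. Block coordinate ascent updates one block of variables by maximizing the objective over that block with the other blocks fixed at their current values (current value of $\mathbf{X}$: $\underline{\mathbf{X}}$). A surrogate function of $F:\mathcal{X}\to\mathbb{R}$ at $\underline{\mathbf{X}}$ is a function $\ell(\cdot,\underline{\mathbf{X}})$ on $\mathcal{X}$ with $\ell(\mathbf{X},\underline{\mathbf{X}})\le F(\mathbf{X})$ for all $\mathbf{X}\in\mathcal{X}$ and $\ell(\underline{\mathbf{X}},\underline{\mathbf{X}})=F(\underline{\mathbf{X}})$.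 *)

theory Defs
  imports
    "Jordan_Normal_Form.Schur_Decomposition"
    "Jordan_Normal_Form.Gauss_Jordan_Elimination"
begin

notation mat_adjoint ("_\<^sup>H" [1000] 999)

(* The library inverse is option-valued; this is only meaningful for invertible A. *)
definition mat_inv :: "complex mat \<Rightarrow> complex mat" where
  "mat_inv A = the (mat_inverse A)"

definition hermitian_mat :: "nat \<Rightarrow> complex mat \<Rightarrow> bool" where
  "hermitian_mat n A \<longleftrightarrow> A \<in> carrier_mat n n \<and> A\<^sup>H = A"

(* (A *\<^sub>v v) \<bullet>c v is v^H A v, which is real for Hermitian A. *)
definition psd :: "nat \<Rightarrow> complex mat \<Rightarrow> bool" where
  "psd n A \<longleftrightarrow> hermitian_mat n A \<and> (\<forall>v \<in> carrier_vec n. 0 \<le> Re ((A *\<^sub>v v) \<bullet>c v))"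

definition pd :: "nat \<Rightarrow> complex mat \<Rightarrow> bool" where
  "pd n A \<longleftrightarrow> hermitian_mat n A \<and>
     (\<forall>v \<in> carrier_vec n. v \<noteq> 0\<^sub>v n \<longrightarrow> 0 < Re ((A *\<^sub>v v) \<bullet>c v))"

definition nondecreasing_herm :: "nat \<Rightarrow> (complex mat \<Rightarrow> real) \<Rightarrow> bool" where
  "nondecreasing_herm m q \<longleftrightarrow>
     (\<forall>Z\<^sub>1 Z\<^sub>2. hermitian_mat m Z\<^sub>1 \<and> hermitian_mat m Z\<^sub>2 \<and> psd m (Z\<^sub>1 - Z\<^sub>2) \<longrightarrow> q Z\<^sub>2 \<le> q Z\<^sub>1)"

(* Twice the Hermitian part of A, not the entrywise real part. *)
definition two_Re :: "complex mat \<Rightarrow> complex mat" where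
  "two_Re A = A + A\<^sup>H"

(* sC k X is the chosen factor of C k X; sC k X need not be square. *)
definition ratio_objective ::
  "nat \<Rightarrow> (nat \<Rightarrow> complex mat \<Rightarrow> real) \<Rightarrow> (nat \<Rightarrow> 'x \<Rightarrow> complex mat) \<Rightarrow>
   (nat \<Rightarrow> 'x \<Rightarrow> complex mat) \<Rightarrow> 'x \<Rightarrow> real" where
  "ratio_objective K q sC D X = (\<Sum>k = 1..K. q k ((sC k X)\<^sup>H * mat_inv (D k X) * sC k X))"

definition quad_objective ::
  "nat \<Rightarrow> (nat \<Rightarrow> complex mat \<Rightarrow> real) \<Rightarrow> (nat \<Rightarrow> 'x \<Rightarrow> complex mat) \<Rightarrow>
   (nat \<Rightarrow> 'x \<Rightarrow> complex mat) \<Rightarrow> 'x \<Rightarrow> (nat \<Rightarrow> complex mat) \<Rightarrow> real" where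
  "quad_objective K q sC D X \<Phi> =
     (\<Sum>k = 1..K. q k (two_Re ((sC k X)\<^sup>H * \<Phi> k) - (\<Phi> k)\<^sup>H * D k X * \<Phi> k))"

(* W\<^sub>1, W\<^sub>2 are the current values of Z\<^sub>1, Z\<^sub>2. *)
definition quad_minorant ::
  "complex mat \<Rightarrow> complex mat \<Rightarrow> complex mat \<Rightarrow> complex mat \<Rightarrow> complex mat" where
  "quad_minorant Z\<^sub>1 Z\<^sub>2 W\<^sub>1 W\<^sub>2 =
     two_Re (W\<^sub>1\<^sup>H * mat_inv W\<^sub>2 * Z\<^sub>1) - W\<^sub>1\<^sup>H * mat_inv W\<^sub>2 * Z\<^sub>2 * mat_inv W\<^sub>2 * W\<^sub>1"

definition quad_surrogate ::
  "nat \<Rightarrow> (nat \<Rightarrow> complex mat \<Rightarrow> real) \<Rightarrow> (nat \<Rightarrow> 'x \<Rightarrow> complex mat) \<Rightarrow>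
   (nat \<Rightarrow> 'x \<Rightarrow> complex mat) \<Rightarrow> 'x \<Rightarrow> 'x \<Rightarrow> real" where
  "quad_surrogate K q sC D X X\<^sub>0 =
     (\<Sum>k = 1..K. q k (quad_minorant (sC k X) (D k X) (sC k X\<^sub>0) (D k X\<^sub>0)))"

definition surrogate_at :: "'x set \<Rightarrow> ('x \<Rightarrow> real) \<Rightarrow> ('x \<Rightarrow> 'x \<Rightarrow> real) \<Rightarrow> 'x \<Rightarrow> bool" where
  "surrogate_at S F l x\<^sub>0 \<longleftrightarrow> (\<forall>x \<in> S. l x x\<^sub>0 \<le> F x) \<and> l x\<^sub>0 x\<^sub>0 = F x\<^sub>0"

end

theory Submission
  imports Defs
begin

text \<open>
  Completing the square: for \<open>D \<succ> 0\<close>,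
  \<open>Z\<^sup>H D\<inverse> Z - (2 Re (Z\<^sup>H \<Phi>) - \<Phi>\<^sup>H D \<Phi>) = (\<Phi> - D\<inverse> Z)\<^sup>H D (\<Phi> - D\<inverse> Z) \<succeq> 0\<close>.
  So each summand of the transformed objective is bounded by the corresponding summand of the
  original one, with equality at \<open>\<Phi> = D\<inverse> Z\<close>; and the quadratic minorant is the transformed
  expression at \<open>\<Phi> = W\<^sub>2\<inverse> W\<^sub>1\<close>.
\<close>

section \<open>Matrix products under dimension equations, which simp can discharge\<close>

lemma mult_mat_assoc:
  fixes A B C :: "'a :: semiring_0 mat"
  shows "dim_col A = dim_row B \<Longrightarrow> dim_col B = dim_row C \<Longrightarrow> A * B * C = A * (B * C)"
  by (rule assoc_mult_mat) auto

lemma mult_mat_vec_assoc: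
  fixes A B :: "'a :: semiring_0 mat"
  shows "dim_col A = dim_row B \<Longrightarrow> dim_col B = dim_vec v \<Longrightarrow> A * B *\<^sub>v v = A *\<^sub>v (B *\<^sub>v v)"
  by (rule assoc_mult_mat_vec) auto

lemma diff_mult_mat:
  fixes A B C :: "'a :: ring mat"
  shows "dim_row A = dim_row B \<Longrightarrow> dim_col A = dim_col B \<Longrightarrow> dim_col B = dim_row C \<Longrightarrow>
    (A - B) * C = A * C - B * C"
  by (rule minus_mult_distrib_mat) auto

lemma mult_diff_mat:
  fixes A B C :: "'a :: ring mat"
  shows "dim_row B = dim_row C \<Longrightarrow> dim_col B = dim_col C \<Longrightarrow> dim_col A = dim_row C \<Longrightarrow>
    A * (B - C) = A * B - A * C"
  by (rule mult_minus_distrib_mat) auto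

section \<open>The conjugate transpose and the complex inner product\<close>

lemma dim_mat_adjoint [simp]:
  "dim_row (A\<^sup>H) = dim_col A" "dim_col (A\<^sup>H) = dim_row A"
  by (simp_all add: mat_adjoint_def)

lemma mat_adjoint_carrier [simp]:
  "A \<in> carrier_mat a b \<Longrightarrow> A\<^sup>H \<in> carrier_mat b a"
  by (intro carrier_matI) simp_all

lemma index_mat_adjoint [simp]:
  "i < dim_col A \<Longrightarrow> j < dim_row A \<Longrightarrow> A\<^sup>H $$ (i, j) = conjugate (A $$ (j, i))"
  by (simp add: mat_adjoint_def mat_of_rows_index)

lemma mat_adjoint_adjoint [simp]: "(A\<^sup>H)\<^sup>H = A"
  by (rule eq_matI) auto

lemma mat_adjoint_add:
  "dim_row A = dim_row B \<Longrightarrow> dim_col A = dim_col B \<Longrightarrow> (A + B)\<^sup>H = A\<^sup>H + B\<^sup>H"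
  by (rule eq_matI) (auto simp: conjugate_dist_add)

lemma mat_adjoint_minus:
  fixes A B :: "complex mat"
  shows "dim_row A = dim_row B \<Longrightarrow> dim_col A = dim_col B \<Longrightarrow> (A - B)\<^sup>H = A\<^sup>H - B\<^sup>H"
  by (rule eq_matI) auto

lemma mat_adjoint_mult:
  fixes A B :: "complex mat"
  shows "dim_col A = dim_row B \<Longrightarrow> (A * B)\<^sup>H = B\<^sup>H * A\<^sup>H"
  by (rule eq_matI) (auto simp: scalar_prod_def mult.commute intro!: sum.cong)

lemma mat_adjoint_one [simp]: "(1\<^sub>m a :: complex mat)\<^sup>H = 1\<^sub>m a"
  by (rule eq_matI) auto

text \<open>Both sides expand to one double sum, read in the two orders of summation. This moves
  \<open>E\<^sup>H\<close> across the inner product in \<open>psd_congruence\<close>.\<close>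

lemma mat_adjoint_cscalar_prod:
  fixes A :: "complex mat"
  assumes A: "A \<in> carrier_mat a b" and w: "w \<in> carrier_vec a" and v: "v \<in> carrier_vec b"
  shows "(A\<^sup>H *\<^sub>v w) \<bullet>c v = w \<bullet>c (A *\<^sub>v v)"
proof -
  have "(A\<^sup>H *\<^sub>v w) \<bullet>c v = (\<Sum>j<b. \<Sum>i<a. cnj (A $$ (i, j)) * w $ i * cnj (v $ j))"
    using A w v by (simp add: scalar_prod_def sum_distrib_right atLeast0LessThan)
  also have "\<dots> = (\<Sum>i<a. \<Sum>j<b. w $ i * cnj (A $$ (i, j) * v $ j))"
    by (subst sum.swap) (simp add: mult_ac)
  also have "\<dots> = w \<bullet>c (A *\<^sub>v v)"
    using A w v by (simp add: scalar_prod_def sum_distrib_left atLeast0LessThan)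
  finally show ?thesis .
qed

section \<open>Hermitian, semidefinite and definite matrices\<close>

lemma hermitian_mat_minus:
  "hermitian_mat n A \<Longrightarrow> hermitian_mat n B \<Longrightarrow> hermitian_mat n (A - B)"
  by (auto simp: hermitian_mat_def mat_adjoint_minus)

lemma hermitian_mat_two_Re:
  assumes "A \<in> carrier_mat n n"
  shows "hermitian_mat n (two_Re A)"
  using assms comm_add_mat[OF mat_adjoint_carrier[OF assms] assms]
  by (simp add: hermitian_mat_def two_Re_def mat_adjoint_add)

text \<open>Taking the adjoint only swaps the two summands. It reconciles the minorant, which
  contains \<open>W\<^sub>1\<^sup>H * mat_inv W\<^sub>2 * Z\<^sub>1\<close>, with the transform,
  which contains the adjoint of that product.\<close>

lemma two_Re_adjoint:
  assumes "A \<in> carrier_mat n n"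
  shows "two_Re (A\<^sup>H) = two_Re A"
  using comm_add_mat[OF assms mat_adjoint_carrier[OF assms]] by (simp add: two_Re_def)

lemma hermitian_mat_congruence:
  assumes D: "hermitian_mat a D" and E: "E \<in> carrier_mat a b"
  shows "hermitian_mat b (E\<^sup>H * D * E)"
proof -
  from D have D': "D \<in> carrier_mat a a" and DH: "D\<^sup>H = D"
    by (auto simp: hermitian_mat_def)
  have "E\<^sup>H * D * E \<in> carrier_mat b b"
    using E D' by (auto intro!: mult_carrier_mat)
  moreover have "(E\<^sup>H * D * E)\<^sup>H = E\<^sup>H * D * E"
    using E D' DH mat_adjoint_mult[of "E\<^sup>H * D" E] mat_adjoint_mult[of "E\<^sup>H" D]
      mult_mat_assoc[of "E\<^sup>H" D E] by simp
  ultimately show ?thesis by (simp add: hermitian_mat_def)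
qed

lemma pd_hermitian: "pd n A \<Longrightarrow> hermitian_mat n A"
  unfolding pd_def by blast

lemma pd_carrier: "pd n A \<Longrightarrow> A \<in> carrier_mat n n"
  unfolding pd_def hermitian_mat_def by blast

lemma pd_adjoint: "pd n A \<Longrightarrow> A\<^sup>H = A"
  unfolding pd_def hermitian_mat_def by blast

lemma pd_imp_psd:
  assumes "pd n A"
  shows "psd n A"
  unfolding psd_def
proof (intro conjI ballI)
  show "hermitian_mat n A" using assms by (rule pd_hermitian)
  fix v :: "complex vec" assume v: "v \<in> carrier_vec n"
  show "0 \<le> Re ((A *\<^sub>v v) \<bullet>c v)"
  proof (cases "v = 0\<^sub>v n")
    \<comment> \<open>The strict inequality in \<open>pd\<close> excludes the zero vector, where the
      form vanishes.\<close>
    case True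
    have "A *\<^sub>v v \<in> carrier_vec n"
      using pd_carrier[OF assms] v by (rule mult_mat_vec_carrier)
    then have "(A *\<^sub>v v) \<bullet>c v = 0" unfolding True by simp
    then show ?thesis by simp
  next
    case False
    then show ?thesis using assms v by (simp add: pd_def less_imp_le)
  qed
qed

text \<open>The form of \<open>E\<^sup>H * D * E\<close> at \<open>v\<close> is the form of
  \<open>D\<close> at \<open>E *\<^sub>v v\<close>.\<close>

lemma psd_congruence:
  assumes D: "psd a D" and E: "E \<in> carrier_mat a b"
  shows "psd b (E\<^sup>H * D * E)"
  unfolding psd_def
proof (intro conjI ballI)
  from D have D': "D \<in> carrier_mat a a" by (simp add: psd_def hermitian_mat_def)
  show "hermitian_mat b (E\<^sup>H * D * E)"
    using D E by (intro hermitian_mat_congruence) (auto simp: psd_def)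
  fix v :: "complex vec" assume v: "v \<in> carrier_vec b"
  have Ev: "E *\<^sub>v v \<in> carrier_vec a" using E v by simp
  have DEv: "D *\<^sub>v (E *\<^sub>v v) \<in> carrier_vec a" using D' Ev by simp
  have eq: "(E\<^sup>H * D * E) *\<^sub>v v = E\<^sup>H *\<^sub>v (D *\<^sub>v (E *\<^sub>v v))"
    using D' E v by (simp add: mult_mat_vec_assoc)
  show "0 \<le> Re ((E\<^sup>H * D * E *\<^sub>v v) \<bullet>c v)"
    unfolding eq mat_adjoint_cscalar_prod[OF E DEv v] using D Ev unfolding psd_def by blast
qed

text \<open>A nonzero kernel vector would make the form vanish, so \<open>A\<close> is invertible
  and \<open>mat_inverse A\<close> is not \<open>None\<close>; only then does \<open>mat_inv\<close>
  denote an actual inverse.\<close>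

lemma pd_mat_inv:
  assumes "pd n A"
  shows mat_inv_carrier: "mat_inv A \<in> carrier_mat n n"
    and mult_mat_inv: "A * mat_inv A = 1\<^sub>m n"
    and mat_inv_adjoint: "(mat_inv A)\<^sup>H = mat_inv A"
proof -
  note A = pd_carrier[OF assms] and AH = pd_adjoint[OF assms]
  have "det A \<noteq> 0"
  proof
    assume "det A = 0"
    then obtain v where v: "v \<in> carrier_vec n" "v \<noteq> 0\<^sub>v n" and Av: "A *\<^sub>v v = 0\<^sub>v n"
      unfolding det_0_iff_vec_prod_zero_field[OF A] by blast
    have "(A *\<^sub>v v) \<bullet>c v = 0" using v unfolding Av by simp
    moreover have "0 < Re ((A *\<^sub>v v) \<bullet>c v)" using assms v by (simp add: pd_def)
    ultimately show False by simp
  qed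
  then have "A \<in> Units (ring_mat TYPE(complex) n ())"
    by (rule det_non_zero_imp_unit[OF A])
  then have "mat_inverse A \<noteq> None"
    using mat_inverse(1)[OF A, where b = "()"] by blast
  then obtain B where "mat_inverse A = Some B" by blast
  then have "A * mat_inv A = 1\<^sub>m n \<and> mat_inv A \<in> carrier_mat n n"
    using mat_inverse(2)[OF A] by (simp add: mat_inv_def)
  then show I: "mat_inv A \<in> carrier_mat n n" and AI: "A * mat_inv A = 1\<^sub>m n"
    by auto
  \<comment> \<open>The adjoint of the right-inverse equation makes
    \<open>(mat_inv A)\<^sup>H\<close> a left inverse, because \<open>A\<close> is Hermitian. A left
    and a right inverse coincide.\<close>
  have "(mat_inv A)\<^sup>H * A = 1\<^sub>m n"
    using mat_adjoint_mult[of A "mat_inv A"] A I AI AH by simp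
  then have "(mat_inv A)\<^sup>H * A * mat_inv A = 1\<^sub>m n * mat_inv A" by simp
  then show "(mat_inv A)\<^sup>H = mat_inv A"
    using A I AI by (simp add: mult_mat_assoc)
qed

section \<open>The quadratic transform of one summand, before \<open>q k\<close> is applied\<close>

definition quad_transform :: "complex mat \<Rightarrow> complex mat \<Rightarrow> complex mat \<Rightarrow> complex mat" where
  "quad_transform Z D \<Phi> = two_Re (Z\<^sup>H * \<Phi>) - \<Phi>\<^sup>H * D * \<Phi>"

lemma hermitian_quad_transform:
  assumes "hermitian_mat a D" "Z \<in> carrier_mat a b" "\<Phi> \<in> carrier_mat a b"
  shows "hermitian_mat b (quad_transform Z D \<Phi>)"
  unfolding quad_transform_def using assms
  by (intro hermitian_mat_minus hermitian_mat_two_Re hermitian_mat_congruence) auto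

lemma complete_square:
  assumes D: "pd a D" and Z: "Z \<in> carrier_mat a b" and \<Phi>: "\<Phi> \<in> carrier_mat a b"
  shows "Z\<^sup>H * mat_inv D * Z - quad_transform Z D \<Phi> =
    (\<Phi> - mat_inv D * Z)\<^sup>H * D * (\<Phi> - mat_inv D * Z)"
proof -
  let ?I = "mat_inv D" and ?\<Psi> = "mat_inv D * Z"
  note I = mat_inv_carrier[OF D]
  note D' = pd_carrier[OF D] and DH = pd_adjoint[OF D]
  have \<Psi>: "?\<Psi> \<in> carrier_mat a b" using I Z by simp
  \<comment> \<open>This and its adjoint remove \<open>D\<close> from the terms of the expanded
    square that contain \<open>?\<Psi>\<close>.\<close>
  have D\<Psi>: "D * ?\<Psi> = Z"
    using assoc_mult_mat[OF D' I Z] mult_mat_inv[OF D] Z by simp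
  have \<Psi>D: "?\<Psi>\<^sup>H * D = Z\<^sup>H"
    using mat_adjoint_mult[of D ?\<Psi>] D' I D\<Psi> DH by simp
  have "(\<Phi> - ?\<Psi>)\<^sup>H * D * (\<Phi> - ?\<Psi>) = (\<Phi>\<^sup>H * D - Z\<^sup>H) * (\<Phi> - ?\<Psi>)"
    using D' I Z \<Phi> \<Psi>D by (simp add: mat_adjoint_minus diff_mult_mat)
  also have "\<dots> = \<Phi>\<^sup>H * D * \<Phi> - Z\<^sup>H * \<Phi> - (\<Phi>\<^sup>H * D * ?\<Psi> - Z\<^sup>H * ?\<Psi>)"
    using D' I Z \<Phi>
    by (simp add: diff_mult_mat mult_diff_mat)
  also have "\<Phi>\<^sup>H * D * ?\<Psi> = (Z\<^sup>H * \<Phi>)\<^sup>H"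
    using D' I Z \<Phi> D\<Psi> by (simp add: mat_adjoint_mult mult_mat_assoc)
  also have "Z\<^sup>H * ?\<Psi> = Z\<^sup>H * ?I * Z"
    using I Z by (simp add: mult_mat_assoc)
  \<comment> \<open>Only a rearrangement of sums remains, checked entrywise.\<close>
  finally show ?thesis
    unfolding quad_transform_def two_Re_def using D' \<Phi> Z I
    by (intro eq_matI) auto
qed

lemma quad_transform_le:
  assumes "nondecreasing_herm b p" "pd a D" "Z \<in> carrier_mat a b" "\<Phi> \<in> carrier_mat a b"
  shows "p (quad_transform Z D \<Phi>) \<le> p (Z\<^sup>H * mat_inv D * Z)"
proof -
  note D = pd_hermitian[OF assms(2)]
  \<comment> \<open>\<open>nondecreasing_herm\<close> compares Hermitian arguments only. The ratio
    is Hermitian as a congruence of the Hermitian inverse.\<close>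
  have "hermitian_mat a (mat_inv D)"
    using pd_mat_inv[OF assms(2)] by (simp add: hermitian_mat_def)
  then have "hermitian_mat b (Z\<^sup>H * mat_inv D * Z)"
    using assms(3) by (rule hermitian_mat_congruence)
  moreover have "psd b (Z\<^sup>H * mat_inv D * Z - quad_transform Z D \<Phi>)"
    unfolding complete_square[OF assms(2-4)]
    using assms mat_inv_carrier[OF assms(2)] by (intro psd_congruence[OF pd_imp_psd]) auto
  ultimately show ?thesis
    using assms(1) hermitian_quad_transform[OF D assms(3,4)] by (auto simp: nondecreasing_herm_def)
qed

text \<open>At this point both outer factors of the square in \<open>complete_square\<close> are
  zero. The equality is one of matrices, so it passes through any \<open>q k\<close>.\<close>

lemma quad_transform_optimal:
  assumes D: "pd a D" and Z: "Z \<in> carrier_mat a b"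
  shows "quad_transform Z D (mat_inv D * Z) = Z\<^sup>H * mat_inv D * Z"
proof -
  note I = mat_inv_carrier[OF D]
  note D' = pd_carrier[OF D]
  let ?\<Psi> = "mat_inv D * Z"
  have \<Psi>: "?\<Psi> \<in> carrier_mat a b" using I Z by simp
  have "Z\<^sup>H * mat_inv D * Z - quad_transform Z D ?\<Psi> = 0\<^sub>m b b"
    using complete_square[OF D Z \<Psi>] D' \<Psi> by (simp add: minus_r_inv_mat[of _ a b])
  moreover have "quad_transform Z D ?\<Psi> \<in> carrier_mat b b"
    using hermitian_quad_transform[OF pd_hermitian[OF D] Z \<Psi>] by (simp add: hermitian_mat_def)
  ultimately show ?thesis using Z I
    by (intro eq_matI) (auto simp: mat_eq_iff)
qed

section \<open>The quadratic minorant as a transform at a fixed auxiliary matrix\<close>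

lemma quad_minorant_eq_quad_transform:
  assumes W2: "pd a W\<^sub>2" and Z1: "Z\<^sub>1 \<in> carrier_mat a b" and W1: "W\<^sub>1 \<in> carrier_mat a b"
    and Z2: "Z\<^sub>2 \<in> carrier_mat a a"
  shows "quad_minorant Z\<^sub>1 Z\<^sub>2 W\<^sub>1 W\<^sub>2 = quad_transform Z\<^sub>1 Z\<^sub>2 (mat_inv W\<^sub>2 * W\<^sub>1)"
proof -
  let ?\<Psi> = "mat_inv W\<^sub>2 * W\<^sub>1"
  note I = mat_inv_carrier[OF W2]
  have \<Psi>: "?\<Psi> \<in> carrier_mat a b" using I W1 by simp
  \<comment> \<open>Since the inverse is Hermitian, the left factors in \<open>quad_minorant\<close>
    are exactly the adjoint of \<open>?\<Psi>\<close>.\<close>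
  have adj: "?\<Psi>\<^sup>H = W\<^sub>1\<^sup>H * mat_inv W\<^sub>2"
    using mat_adjoint_mult[of "mat_inv W\<^sub>2" W\<^sub>1] I W1 mat_inv_adjoint[OF W2] by simp
  have "(Z\<^sub>1\<^sup>H * ?\<Psi>)\<^sup>H = ?\<Psi>\<^sup>H * Z\<^sub>1"
    using Z1 I W1 mat_adjoint_mult[of "Z\<^sub>1\<^sup>H" ?\<Psi>] by simp
  then have "two_Re (?\<Psi>\<^sup>H * Z\<^sub>1) = two_Re (Z\<^sub>1\<^sup>H * ?\<Psi>)"
    using two_Re_adjoint[OF mult_carrier_mat[OF mat_adjoint_carrier[OF Z1] \<Psi>]] by simp
  moreover have "?\<Psi>\<^sup>H * Z\<^sub>2 * mat_inv W\<^sub>2 * W\<^sub>1 = ?\<Psi>\<^sup>H * Z\<^sub>2 * ?\<Psi>"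
    using \<Psi> Z2 I W1 by (simp add: mult_mat_assoc)
  ultimately show ?thesis
    by (simp add: quad_minorant_def quad_transform_def adj)
qed

lemma quad_minorant_le:
  assumes "nondecreasing_herm b p" "pd a Z\<^sub>2" "pd a W\<^sub>2"
    "Z\<^sub>1 \<in> carrier_mat a b" "W\<^sub>1 \<in> carrier_mat a b"
  shows "p (quad_minorant Z\<^sub>1 Z\<^sub>2 W\<^sub>1 W\<^sub>2) \<le> p (Z\<^sub>1\<^sup>H * mat_inv Z\<^sub>2 * Z\<^sub>1)"
proof -
  have "mat_inv W\<^sub>2 * W\<^sub>1 \<in> carrier_mat a b"
    using mat_inv_carrier[OF assms(3)] assms(5) by (rule mult_carrier_mat)
  with assms(1,2,4) show ?thesis
    unfolding quad_minorant_eq_quad_transform[OF assms(3,4,5) pd_carrier[OF assms(2)]]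
    by (rule quad_transform_le)
qed

lemma quad_minorant_refl:
  assumes "pd a W\<^sub>2" "W\<^sub>1 \<in> carrier_mat a b"
  shows "quad_minorant W\<^sub>1 W\<^sub>2 W\<^sub>1 W\<^sub>2 = W\<^sub>1\<^sup>H * mat_inv W\<^sub>2 * W\<^sub>1"
  using quad_minorant_eq_quad_transform[OF assms(1,2,2) pd_carrier[OF assms(1)]]
    quad_transform_optimal[OF assms]
  by (rule trans)

text \<open>The last two conjuncts record where the surrogate comes from: a lower bound for an
  arbitrary nondecreasing \<open>p\<close>, and its use on each summand. The feasible set prescribes
  dimensions at the indices \<open>1..K\<close>, the only ones that the objective reads.\<close>

theorem proposition15:
  fixes \<X> :: "'x set"
    and K :: nat
    and n m :: "nat \<Rightarrow> nat"
    and C D sC :: "nat \<Rightarrow> 'x \<Rightarrow> complex mat"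
    and q :: "nat \<Rightarrow> complex mat \<Rightarrow> real"
    and X\<^sub>0 :: 'x
    and \<Phi>\<^sub>0 :: "nat \<Rightarrow> complex mat"
  assumes C_psd: "\<And>k X. k \<in> {1..K} \<Longrightarrow> X \<in> \<X> \<Longrightarrow> psd (n k) (C k X)"
    and D_pd: "\<And>k X. k \<in> {1..K} \<Longrightarrow> X \<in> \<X> \<Longrightarrow> pd (n k) (D k X)"
    and sC_dim: "\<And>k X. k \<in> {1..K} \<Longrightarrow> X \<in> \<X> \<Longrightarrow> sC k X \<in> carrier_mat (n k) (m k)"
    and sC_factor: "\<And>k X. k \<in> {1..K} \<Longrightarrow> X \<in> \<X> \<Longrightarrow> sC k X * (sC k X)\<^sup>H = C k X"
    and q_mono: "\<And>k. k \<in> {1..K} \<Longrightarrow> nondecreasing_herm (m k) (q k)"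
    and X\<^sub>0: "X\<^sub>0 \<in> \<X>"
    and \<Phi>\<^sub>0: "\<And>k. k \<in> {1..K} \<Longrightarrow> \<Phi>\<^sub>0 k = mat_inv (D k X\<^sub>0) * sC k X\<^sub>0"
  shows
    "is_arg_max (quad_objective K q sC D X\<^sub>0)
       (\<lambda>\<Phi>. \<forall>k \<in> {1..K}. \<Phi> k \<in> carrier_mat (n k) (m k)) \<Phi>\<^sub>0
     \<and> (\<forall>X \<in> \<X>. quad_objective K q sC D X \<Phi>\<^sub>0 = quad_surrogate K q sC D X X\<^sub>0)
     \<and> surrogate_at \<X> (ratio_objective K q sC D) (quad_surrogate K q sC D) X\<^sub>0
     \<and> (\<forall>k \<in> {1..K}. surrogate_at \<X>
          (\<lambda>X. q k ((sC k X)\<^sup>H * mat_inv (D k X) * sC k X))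
          (\<lambda>X Y. q k (quad_minorant (sC k X) (D k X) (sC k Y) (D k Y))) X\<^sub>0)
     \<and> (\<forall>(a::nat) (b::nat) (p :: complex mat \<Rightarrow> real) Z\<^sub>1 Z\<^sub>2 W\<^sub>1 W\<^sub>2.
          nondecreasing_herm b p \<and> pd a Z\<^sub>2 \<and> pd a W\<^sub>2 \<and>
          Z\<^sub>1 \<in> carrier_mat a b \<and> W\<^sub>1 \<in> carrier_mat a b \<longrightarrow>
          p (quad_minorant Z\<^sub>1 Z\<^sub>2 W\<^sub>1 W\<^sub>2) \<le> p (Z\<^sub>1\<^sup>H * mat_inv Z\<^sub>2 * Z\<^sub>1) \<and>
          p (quad_minorant W\<^sub>1 W\<^sub>2 W\<^sub>1 W\<^sub>2) = p (W\<^sub>1\<^sup>H * mat_inv W\<^sub>2 * W\<^sub>1))"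
proof (intro conjI ballI allI impI)
  have carrier0: "\<Phi>\<^sub>0 k \<in> carrier_mat (n k) (m k)" if "k \<in> {1..K}" for k
    using that mat_inv_carrier[OF D_pd[OF that X\<^sub>0]] sC_dim[OF that X\<^sub>0] by (simp add: \<Phi>\<^sub>0)
  have h_eq: "quad_objective K q sC D X \<Phi> = (\<Sum>k = 1..K. q k (quad_transform (sC k X) (D k X) (\<Phi> k)))"
    for X \<Phi> by (simp add: quad_objective_def quad_transform_def)
  have opt: "quad_transform (sC k X\<^sub>0) (D k X\<^sub>0) (\<Phi>\<^sub>0 k)
      = (sC k X\<^sub>0)\<^sup>H * mat_inv (D k X\<^sub>0) * sC k X\<^sub>0" if "k \<in> {1..K}" for k
    using quad_transform_optimal[OF D_pd[OF that X\<^sub>0] sC_dim[OF that X\<^sub>0]] that by (simp add: \<Phi>\<^sub>0)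
  show "is_arg_max (quad_objective K q sC D X\<^sub>0)
       (\<lambda>\<Phi>. \<forall>k \<in> {1..K}. \<Phi> k \<in> carrier_mat (n k) (m k)) \<Phi>\<^sub>0"
    unfolding is_arg_max_linorder
  proof (intro conjI allI impI ballI)
    fix \<Phi> :: "nat \<Rightarrow> complex mat"
    assume "\<forall>k \<in> {1..K}. \<Phi> k \<in> carrier_mat (n k) (m k)"
    \<comment> \<open>The maximization separates: the summand with index \<open>k\<close> involves
      only \<open>\<Phi> k\<close>, and its upper bound is attained at
      \<open>\<Phi>\<^sub>0 k\<close>.\<close>
    then show "quad_objective K q sC D X\<^sub>0 \<Phi> \<le> quad_objective K q sC D X\<^sub>0 \<Phi>\<^sub>0"
      unfolding h_eq
      by (intro sum_mono) (simp add: opt quad_transform_le[OF q_mono D_pd sC_dim] X\<^sub>0)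
  qed (rule carrier0)
  show "quad_objective K q sC D X \<Phi>\<^sub>0 = quad_surrogate K q sC D X X\<^sub>0" if X: "X \<in> \<X>" for X
    unfolding h_eq quad_surrogate_def
  proof (rule sum.cong[OF refl])
    fix k assume k: "k \<in> {1..K}"
    show "q k (quad_transform (sC k X) (D k X) (\<Phi>\<^sub>0 k)) =
      q k (quad_minorant (sC k X) (D k X) (sC k X\<^sub>0) (D k X\<^sub>0))"
      unfolding \<Phi>\<^sub>0[OF k] quad_minorant_eq_quad_transform[OF D_pd[OF k X\<^sub>0] sC_dim[OF k X]
        sC_dim[OF k X\<^sub>0] pd_carrier[OF D_pd[OF k X]]] ..
  qed
  have le: "q k (quad_minorant (sC k X) (D k X) (sC k X\<^sub>0) (D k X\<^sub>0))
      \<le> q k ((sC k X)\<^sup>H * mat_inv (D k X) * sC k X)" if "k \<in> {1..K}" "X \<in> \<X>" for k X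
    by (rule quad_minorant_le[OF q_mono[OF that(1)] D_pd[OF that] D_pd[OF that(1) X\<^sub>0]
        sC_dim[OF that] sC_dim[OF that(1) X\<^sub>0]])
  have refl: "quad_minorant (sC k X\<^sub>0) (D k X\<^sub>0) (sC k X\<^sub>0) (D k X\<^sub>0)
      = (sC k X\<^sub>0)\<^sup>H * mat_inv (D k X\<^sub>0) * sC k X\<^sub>0" if "k \<in> {1..K}" for k
    by (rule quad_minorant_refl[OF D_pd[OF that X\<^sub>0] sC_dim[OF that X\<^sub>0]])
  \<comment> \<open>Bound and tightness hold for each summand, so they add up.\<close>
  show "surrogate_at \<X> (ratio_objective K q sC D) (quad_surrogate K q sC D) X\<^sub>0"
    unfolding surrogate_at_def ratio_objective_def quad_surrogate_def
    by (auto intro!: sum_mono sum.cong le simp: refl)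
  show "surrogate_at \<X> (\<lambda>X. q k ((sC k X)\<^sup>H * mat_inv (D k X) * sC k X))
      (\<lambda>X Y. q k (quad_minorant (sC k X) (D k X) (sC k Y) (D k Y))) X\<^sub>0" if "k \<in> {1..K}" for k
    using that by (simp add: surrogate_at_def le refl)
\<comment> \<open>Left are the general lower bound and its equality case.\<close>
qed (auto simp: quad_minorant_refl intro: quad_minorant_le)

end
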